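(* Let $\mathbb{K}$ be an algebraically closed field of characteristic $0$. Let $\mathcal{A}$ be a finite-dimensional unital associative $\mathbb{K}$-algebra with unit $e_1=1$. Let $\mathfrak{b}=\mathfrak{b}_1\cup\mathfrak{b}_2$ be a basis of $\mathcal{A}$ with $\mathfrak{b}_1=\{e_i\}_{i=1,\dots,p}$. Assume that $\mathrm{span}(\mathfrak{b}_2)$ is a subalgebra of $\mathcal{A}$ and $$e_i\cdot e_j=e_{\max(i,j)}\quad\forall i,j=1,\dots,p,\qquad e_i\cdot f=f\cdot e_i=f\quad\forall i=1,\dots,p,\ \forall f\in\mathfrak{b}_2.$$ Then the (linear) comultiplication $\Delta$ and counit $\varepsilon$ defined on the basis by $$\Delta(e_p)=e_p\otimes e_p,\qquad \Delta(e_i)=(e_i-e_{i+1})\otimes(e_i-e_{i+1})+\Delta(e_{i+1})\quad (i=1,\dots,p-1),$$ $$\Delta(f)=f\otimes f\quad\forall f\in\mathfrak{b}_2,\qquad \varepsilon(e_i)=p-i+1\quad(i=1,\dots,p),\qquad \varepsilon(f)=1\quad\forall f\in\mathfrak{b}_2,$$ endow $\mathcal{A}$ with a weak bialgebra structure.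
   Context: Weak bialgebra. Write $xy=m(x\otimes y)$ and use Sweedler notation $\Delta(x)=x_{(1)}\otimes x_{(2)}$ (summation understood). A weak bialgebra is a quintuple $(V,m,\eta,\Delta,\varepsilon)$ with linear maps $m:V\otimes V\to V$, $\eta:\mathbb{K}\to V$ (write $1=\eta(1)$), $\Delta:V\to V\otimes V$, $\varepsilon:V\to\mathbb{K}$ such that: (1) $(V,m,\eta)$ is a unital associative algebra; (2) $(V,\Delta,\varepsilon)$ is a coassociative counital coalgebra; (3) for all $x,y,z\in V$: $\Delta(xy)=\Delta(x)\bullet\Delta(y)$; $(\Delta\otimes \mathrm{id})\Delta(1)=(\Delta(1)\otimes 1)\bullet(1\otimes\Delta(1))=(1\otimes\Delta(1))\bullet(\Delta(1)\otimes 1)$; and $\varepsilon(xyz)=\varepsilon(xy_{(1)})\,\varepsilon(y_{(2)}z)$. Here $\bullet$ is the usual componentwise multiplication on tensor powers of $V$.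
   Formalization: The basis b_2 itself is assumed closed under multiplication, not only span(b_2) a subalgebra; without this the claim fails (p=1, b_2={f}, f·f=2f gives Δ(ff)=2f⊗f but Δ(f)•Δ(f)=4f⊗f), and the conclusion forces it. *)

theory Defs
  imports "HOL-Computational_Algebra.Polynomial" "HOL-Library.Function_Algebras"
begin

section \<open>Algebras over a field\<close>

locale k_algebra = vector_space scale
  for scale :: "'k::field \<Rightarrow> 'a::ring_1 \<Rightarrow> 'a" +
  assumes scale_mult_left: "scale c x * y = scale c (x * y)"
    and scale_mult_right: "x * scale c y = scale c (x * y)"

text \<open>Subalgebras are not required to contain the unit.\<close>

definition subalgebra :: "('k::field \<Rightarrow> 'a::ring_1 \<Rightarrow> 'a) \<Rightarrow> 'a set \<Rightarrow> bool" where
  "subalgebra scale S \<longleftrightarrow> module.subspace scale S \<and> (\<forall>x\<in>S. \<forall>y\<in>S. x * y \<in> S)"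


section \<open>Tensor powers\<close>

text \<open>
  The library has no tensor product of vector spaces. We realise \<open>x \<otimes> y\<close> as evaluation at
  \<open>(x, y)\<close> on bilinear forms, and \<open>V \<otimes> V\<close> as the span of these elements. This is a tensor
  product in any dimension: lemmas \<open>lift2\<close> and \<open>lift2_unique\<close> below are the universal property.
  The value 0 outside the bilinear forms makes \<open>\<otimes>\<close> bilinear. All linear maps
  out of \<open>V \<otimes> V\<close> are obtained from \<open>lift2\<close>: if \<open>t\<close> is the sum of the \<open>t\<^sub>1 \<otimes> t\<^sub>2\<close> then
  \<open>lift2 scale scaleW (\<lambda>x y. \<beta> x y) t\<close> is the sum of the \<open>\<beta> t\<^sub>1 t\<^sub>2\<close>, that is, Sweedler notation.
  The same is done for \<open>V \<otimes> V \<otimes> V\<close> with trilinear forms.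
\<close>

definition bilinear_map ::
  "('k::field \<Rightarrow> 'a::ab_group_add \<Rightarrow> 'a) \<Rightarrow> ('k \<Rightarrow> 'w::ab_group_add \<Rightarrow> 'w) \<Rightarrow> ('a \<Rightarrow> 'a \<Rightarrow> 'w) \<Rightarrow> bool" where
  "bilinear_map scale scaleW \<beta> \<longleftrightarrow>
     (\<forall>y. Vector_Spaces.linear scale scaleW (\<lambda>x. \<beta> x y)) \<and>
     (\<forall>x. Vector_Spaces.linear scale scaleW (\<lambda>y. \<beta> x y))"

definition trilinear_map ::
  "('k::field \<Rightarrow> 'a::ab_group_add \<Rightarrow> 'a) \<Rightarrow> ('k \<Rightarrow> 'w::ab_group_add \<Rightarrow> 'w) \<Rightarrow> ('a \<Rightarrow> 'a \<Rightarrow> 'a \<Rightarrow> 'w) \<Rightarrow> bool" where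
  "trilinear_map scale scaleW \<beta> \<longleftrightarrow>
     (\<forall>y z. Vector_Spaces.linear scale scaleW (\<lambda>x. \<beta> x y z)) \<and>
     (\<forall>x z. Vector_Spaces.linear scale scaleW (\<lambda>y. \<beta> x y z)) \<and>
     (\<forall>x y. Vector_Spaces.linear scale scaleW (\<lambda>z. \<beta> x y z))"

type_synonym ('a, 'k) tensor2 = "('a \<Rightarrow> 'a \<Rightarrow> 'k) \<Rightarrow> 'k"
type_synonym ('a, 'k) tensor3 = "('a \<Rightarrow> 'a \<Rightarrow> 'a \<Rightarrow> 'k) \<Rightarrow> 'k"

definition fscale :: "'k::field \<Rightarrow> ('i \<Rightarrow> 'k) \<Rightarrow> 'i \<Rightarrow> 'k" where
  "fscale c t = (\<lambda>i. c * t i)"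

definition tensor2 :: "('k::field \<Rightarrow> 'a::ab_group_add \<Rightarrow> 'a) \<Rightarrow> 'a \<Rightarrow> 'a \<Rightarrow> ('a, 'k) tensor2" where
  "tensor2 scale x y = (\<lambda>\<beta>. if bilinear_map scale (*) \<beta> then \<beta> x y else 0)"

definition tensor3 :: "('k::field \<Rightarrow> 'a::ab_group_add \<Rightarrow> 'a) \<Rightarrow> 'a \<Rightarrow> 'a \<Rightarrow> 'a \<Rightarrow> ('a, 'k) tensor3" where
  "tensor3 scale x y z = (\<lambda>\<beta>. if trilinear_map scale (*) \<beta> then \<beta> x y z else 0)"

definition tensor_space2 :: "('k::field \<Rightarrow> 'a::ab_group_add \<Rightarrow> 'a) \<Rightarrow> ('a, 'k) tensor2 set" where
  "tensor_space2 scale = module.span fscale {tensor2 scale x y | x y. True}"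

definition tensor_space3 :: "('k::field \<Rightarrow> 'a::ab_group_add \<Rightarrow> 'a) \<Rightarrow> ('a, 'k) tensor3 set" where
  "tensor_space3 scale = module.span fscale {tensor3 scale x y z | x y z. True}"

definition lift2 ::
  "('k::field \<Rightarrow> 'a::ab_group_add \<Rightarrow> 'a) \<Rightarrow> ('k \<Rightarrow> 'w::ab_group_add \<Rightarrow> 'w) \<Rightarrow>
   ('a \<Rightarrow> 'a \<Rightarrow> 'w) \<Rightarrow> ('a, 'k) tensor2 \<Rightarrow> 'w" where
  "lift2 scale scaleW \<beta> =
     (SOME f. Vector_Spaces.linear fscale scaleW f \<and> (\<forall>x y. f (tensor2 scale x y) = \<beta> x y))"

definition lift3 ::
  "('k::field \<Rightarrow> 'a::ab_group_add \<Rightarrow> 'a) \<Rightarrow> ('k \<Rightarrow> 'w::ab_group_add \<Rightarrow> 'w) \<Rightarrow>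
   ('a \<Rightarrow> 'a \<Rightarrow> 'a \<Rightarrow> 'w) \<Rightarrow> ('a, 'k) tensor3 \<Rightarrow> 'w" where
  "lift3 scale scaleW \<beta> =
     (SOME f. Vector_Spaces.linear fscale scaleW f \<and> (\<forall>x y z. f (tensor3 scale x y z) = \<beta> x y z))"


subsection \<open>The universal properties\<close>

lemma vector_space_mult: "vector_space ((*) :: 'k::field \<Rightarrow> 'k \<Rightarrow> 'k)"
  by unfold_locales (auto simp: algebra_simps)

lemma vector_space_fscale: "vector_space (fscale :: 'k::field \<Rightarrow> ('i \<Rightarrow> 'k) \<Rightarrow> 'i \<Rightarrow> 'k)"
  by unfold_locales (auto simp: fscale_def fun_eq_iff algebra_simps)

lemma linearI:
  assumes "vector_space s1" "vector_space s2"
    "\<And>x y. f (x + y) = f x + f y" "\<And>c x. f (s1 c x) = s2 c (f x)"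
  shows "Vector_Spaces.linear s1 s2 f"
  using assms by (simp add: Vector_Spaces.linear_iff)

lemma linearD:
  assumes "Vector_Spaces.linear s1 s2 f"
  shows "f (x + y) = f x + f y" "f (s1 c x) = s2 c (f x)"
    "vector_space s1" "vector_space s2"
  using assms by (auto simp: Vector_Spaces.linear_iff)

lemma linear_fscaleI:
  assumes "vector_space s" "\<And>i. Vector_Spaces.linear s (*) (\<lambda>x. f x i) \<or> (\<forall>x. f x i = 0)"
  shows "Vector_Spaces.linear s fscale f"
proof (rule linearI)
  show "f (x + y) = f x + f y" for x y
  proof
    fix i show "f (x + y) i = (f x + f y) i"
      using assms(2)[of i] by (auto dest: linearD)
  qed
  show "f (s c x) = fscale c (f x)" for c x
  proof
    fix i show "f (s c x) i = fscale c (f x) i"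
      using assms(2)[of i] by (auto simp: fscale_def dest: linearD)
  qed
qed (use assms vector_space_fscale in auto)

lemma bilinear_tensor2:
  assumes "vector_space scale"
  shows "bilinear_map scale fscale (tensor2 scale)"
  unfolding bilinear_map_def
  by (intro conjI allI linear_fscaleI assms) (auto simp: tensor2_def bilinear_map_def)

lemma trilinear_tensor3:
  assumes "vector_space scale"
  shows "trilinear_map scale fscale (tensor3 scale)"
  unfolding trilinear_map_def
  by (intro conjI allI linear_fscaleI assms) (auto simp: tensor3_def trilinear_map_def)

lemma linear_extend_biorthogonal:
  fixes p :: "'j \<Rightarrow> 'i \<Rightarrow> 'k::field" and scaleW :: "'k \<Rightarrow> 'w::ab_group_add \<Rightarrow> 'w"
  assumes W: "vector_space scaleW"
    and pq: "\<And>i j. i \<in> I \<Longrightarrow> j \<in> I \<Longrightarrow> p i (q j) = (if i = j then 1 else 0)"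
  shows "\<exists>f. Vector_Spaces.linear fscale scaleW f \<and> (\<forall>i\<in>I. f (p i) = g i)"
proof -
  interpret F: vector_space "fscale :: 'k \<Rightarrow> ('i \<Rightarrow> 'k) \<Rightarrow> 'i \<Rightarrow> 'k"
    by (rule vector_space_fscale)
  interpret W: vector_space scaleW by (rule W)
  interpret FW: vector_space_pair "fscale :: 'k \<Rightarrow> ('i \<Rightarrow> 'k) \<Rightarrow> 'i \<Rightarrow> 'k" scaleW
    by unfold_locales
  have inj: "inj_on p I"
    by (metis pq inj_onI zero_neq_one)
  have sum_apply: "(\<Sum>v\<in>A. fscale (u v) v) j = (\<Sum>v\<in>A. u v * v j)"
    for u :: "('i \<Rightarrow> 'k) \<Rightarrow> 'k" and A j
    by (induction A rule: infinite_finite_induct) (auto simp: fscale_def)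
  have "F.independent (p ` I)"
    unfolding F.dependent_explicit
  proof safe
    fix A and u :: "('i \<Rightarrow> 'k) \<Rightarrow> 'k" and v
    assume A: "finite A" "A \<subseteq> p ` I" and 0: "(\<Sum>v\<in>A. fscale (u v) v) = 0"
      and v: "v \<in> A" "u v \<noteq> 0"
    obtain j where j: "j \<in> I" "v = p j" using A v by auto
    have "0 = (\<Sum>w\<in>A. u w * w (q j))"
      using sum_apply[of u A "q j"] 0 by simp
    also have "\<dots> = (\<Sum>w\<in>A. if w = v then u v else 0)"
    proof (rule sum.cong[OF refl])
      fix w assume "w \<in> A"
      then obtain i where i: "i \<in> I" "w = p i" using A by auto
      show "u w * w (q j) = (if w = v then u v else 0)"
        using i j inj_on_eq_iff[OF inj] by (simp add: pq)
    qed
    also have "\<dots> = u v" using A v by simp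
    finally show False using v by simp
  qed
  from FW.linear_independent_extend[OF this, of "\<lambda>v. g (the_inv_into I p v)"]
  show ?thesis by (auto simp: the_inv_into_f_f[OF inj])
qed

lemma dual_basis:
  assumes "vector_space scale"
  shows "\<exists>B r. module.span scale B = UNIV \<and>
    (\<forall>b. Vector_Spaces.linear scale (*) (r b)) \<and>
    (\<forall>b\<in>B. \<forall>c\<in>B. r b c = (if b = c then 1 else (0::'k::field)))"
proof -
  interpret vector_space scale by fact
  define B where "B = extend_basis {}"
  have B: "independent B" "span B = UNIV"
    using independent_extend_basis[OF independent_empty] span_extend_basis[OF independent_empty]
    by (simp_all add: B_def)
  have "Vector_Spaces.linear scale (*) (\<lambda>x. representation B x b)" for b
    by (rule linearI)
      (auto simp: assms vector_space_mult representation_add representation_scale B)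
  moreover have "representation B c b = (if b = c then 1 else 0)" if "c \<in> B" for b c
    using that B by (auto simp: representation_basis)
  ultimately show ?thesis
    using B by (intro exI[of _ B] exI[of _ "\<lambda>b x. representation B x b"]) auto
qed

lemma linear_eqI_span:
  assumes "Vector_Spaces.linear sV sW f" "Vector_Spaces.linear sV sW g"
    and "x \<in> module.span sV B" "\<And>b. b \<in> B \<Longrightarrow> f b = g b"
  shows "f x = g x"
proof -
  interpret vector_space_pair sV sW
    using assms(1) by (auto simp: vector_space_pair_def dest: linearD)
  show ?thesis by (rule linear_eq_on) (use assms in auto)
qed

lemma linear_mult_const:
  assumes "Vector_Spaces.linear s (*) f"
  shows "Vector_Spaces.linear s (*) (\<lambda>x. f x * (c::'k::field))"
    "Vector_Spaces.linear s (*) (\<lambda>x. c * f x)"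
  using assms by (auto simp: Vector_Spaces.linear_iff algebra_simps)

lemma linear_comp:
  assumes "Vector_Spaces.linear s1 s2 f" "Vector_Spaces.linear s2 s3 g"
  shows "Vector_Spaces.linear s1 s3 (\<lambda>x. g (f x))"
  using assms by (auto simp: Vector_Spaces.linear_iff)

theorem lift2:
  fixes scale :: "'k::field \<Rightarrow> 'a::ab_group_add \<Rightarrow> 'a"
  assumes \<beta>: "bilinear_map scale scaleW \<beta>"
  shows "Vector_Spaces.linear fscale scaleW (lift2 scale scaleW \<beta>)"
    and "lift2 scale scaleW \<beta> (tensor2 scale x y) = \<beta> x y"
proof -
  note l = \<beta>[unfolded bilinear_map_def]
  have V: "vector_space scale" and W: "vector_space scaleW"
    using l by (auto dest: linearD)
  obtain B r where B: "module.span scale B = UNIV"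
    and r: "\<And>b. Vector_Spaces.linear scale (*) (r b)"
    and rB: "\<And>b c. b \<in> B \<Longrightarrow> c \<in> B \<Longrightarrow> r b c = (if b = c then 1 else (0::'k))"
    using dual_basis[OF V] by blast
  have bil: "bilinear_map scale (*) (\<lambda>x y. r b x * r c y)" for b c
    unfolding bilinear_map_def using linear_mult_const[OF r] by blast
  have "\<exists>f. Vector_Spaces.linear fscale scaleW f \<and>
      (\<forall>i\<in>B \<times> B. f (case i of (b, c) \<Rightarrow> tensor2 scale b c) = (case i of (b, c) \<Rightarrow> \<beta> b c))"
    by (rule linear_extend_biorthogonal[OF W, where q = "\<lambda>(b, c) x y. r b x * r c y"])
       (auto simp: tensor2_def bil rB split: if_splits)
  then obtain f where f: "Vector_Spaces.linear fscale scaleW f"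
    and fB: "\<And>b c. b \<in> B \<Longrightarrow> c \<in> B \<Longrightarrow> f (tensor2 scale b c) = \<beta> b c"
    by auto
  note t = bilinear_tensor2[OF V, unfolded bilinear_map_def]
  have 1: "f (tensor2 scale x c) = \<beta> x c" if "c \<in> B" for x c
    by (rule linear_eqI_span[where sV = scale and B = B and sW = scaleW])
       (use B fB that l t in \<open>auto intro!: linear_comp[OF _ f]\<close>)
  have "f (tensor2 scale x y) = \<beta> x y" for x y
    by (rule linear_eqI_span[where sV = scale and B = B and sW = scaleW])
       (use B 1 l t in \<open>auto intro!: linear_comp[OF _ f]\<close>)
  with f have "\<exists>f. Vector_Spaces.linear fscale scaleW f \<and> (\<forall>x y. f (tensor2 scale x y) = \<beta> x y)"
    by blast
  from someI_ex[OF this, folded lift2_def]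
  show "Vector_Spaces.linear fscale scaleW (lift2 scale scaleW \<beta>)"
    "lift2 scale scaleW \<beta> (tensor2 scale x y) = \<beta> x y" by auto
qed

theorem lift3:
  fixes scale :: "'k::field \<Rightarrow> 'a::ab_group_add \<Rightarrow> 'a"
  assumes \<beta>: "trilinear_map scale scaleW \<beta>"
  shows "Vector_Spaces.linear fscale scaleW (lift3 scale scaleW \<beta>)"
    and "lift3 scale scaleW \<beta> (tensor3 scale x y z) = \<beta> x y z"
proof -
  note l = \<beta>[unfolded trilinear_map_def]
  have V: "vector_space scale" and W: "vector_space scaleW"
    using l by (auto dest: linearD)
  obtain B r where B: "module.span scale B = UNIV"
    and r: "\<And>b. Vector_Spaces.linear scale (*) (r b)"
    and rB: "\<And>b c. b \<in> B \<Longrightarrow> c \<in> B \<Longrightarrow> r b c = (if b = c then 1 else (0::'k))"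
    using dual_basis[OF V] by blast
  have tri: "trilinear_map scale (*) (\<lambda>x y z. r b x * r c y * r d z)" for b c d
    unfolding trilinear_map_def
    by (intro conjI allI linear_mult_const r)
  have "\<exists>f. Vector_Spaces.linear fscale scaleW f \<and>
      (\<forall>i\<in>B \<times> B \<times> B. f (case i of (b, c, d) \<Rightarrow> tensor3 scale b c d) =
        (case i of (b, c, d) \<Rightarrow> \<beta> b c d))"
    by (rule linear_extend_biorthogonal[OF W, where q = "\<lambda>(b, c, d) x y z. r b x * r c y * r d z"])
       (auto simp: tensor3_def tri rB split: if_splits)
  then obtain f where f: "Vector_Spaces.linear fscale scaleW f"
    and fB: "\<And>b c d. b \<in> B \<Longrightarrow> c \<in> B \<Longrightarrow> d \<in> B \<Longrightarrow> f (tensor3 scale b c d) = \<beta> b c d"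
    by auto
  note t = trilinear_tensor3[OF V, unfolded trilinear_map_def]
  have 1: "f (tensor3 scale x c d) = \<beta> x c d" if "c \<in> B" "d \<in> B" for x c d
    by (rule linear_eqI_span[where sV = scale and B = B and sW = scaleW])
       (use B fB that l t in \<open>auto intro!: linear_comp[OF _ f]\<close>)
  have 2: "f (tensor3 scale x y d) = \<beta> x y d" if "d \<in> B" for x y d
    by (rule linear_eqI_span[where sV = scale and B = B and sW = scaleW])
       (use B 1 that l t in \<open>auto intro!: linear_comp[OF _ f]\<close>)
  have "f (tensor3 scale x y z) = \<beta> x y z" for x y z
    by (rule linear_eqI_span[where sV = scale and B = B and sW = scaleW])
       (use B 2 l t in \<open>auto intro!: linear_comp[OF _ f]\<close>)
  with f have "\<exists>f. Vector_Spaces.linear fscale scaleW f \<and> (\<forall>x y z. f (tensor3 scale x y z) = \<beta> x y z)"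
    by blast
  from someI_ex[OF this, folded lift3_def]
  show "Vector_Spaces.linear fscale scaleW (lift3 scale scaleW \<beta>)"
    "lift3 scale scaleW \<beta> (tensor3 scale x y z) = \<beta> x y z" by auto
qed

theorem lift2_unique:
  assumes "bilinear_map scale scaleW \<beta>"
    and "Vector_Spaces.linear fscale scaleW f" "\<And>x y. f (tensor2 scale x y) = \<beta> x y"
    and "t \<in> tensor_space2 scale"
  shows "f t = lift2 scale scaleW \<beta> t"
  by (rule linear_eqI_span[OF assms(2) lift2(1)[OF assms(1)] assms(4)[unfolded tensor_space2_def]])
     (auto simp: assms(3) lift2(2)[OF assms(1)])

theorem lift3_unique:
  assumes "trilinear_map scale scaleW \<beta>"
    and "Vector_Spaces.linear fscale scaleW f" "\<And>x y z. f (tensor3 scale x y z) = \<beta> x y z"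
    and "t \<in> tensor_space3 scale"
  shows "f t = lift3 scale scaleW \<beta> t"
  by (rule linear_eqI_span[OF assms(2) lift3(1)[OF assms(1)] assms(4)[unfolded tensor_space3_def]])
     (auto simp: assms(3) lift3(2)[OF assms(1)])


section \<open>Weak bialgebras\<close>

definition tensor2_mult :: "('k::field \<Rightarrow> 'a::ring_1 \<Rightarrow> 'a) \<Rightarrow>
    ('a, 'k) tensor2 \<Rightarrow> ('a, 'k) tensor2 \<Rightarrow> ('a, 'k) tensor2" where
  "tensor2_mult scale s t =
     lift2 scale fscale (\<lambda>x y. lift2 scale fscale (\<lambda>x' y'. tensor2 scale (x * x') (y * y')) t) s"

definition tensor3_mult :: "('k::field \<Rightarrow> 'a::ring_1 \<Rightarrow> 'a) \<Rightarrow>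
    ('a, 'k) tensor3 \<Rightarrow> ('a, 'k) tensor3 \<Rightarrow> ('a, 'k) tensor3" where
  "tensor3_mult scale s t =
     lift3 scale fscale
       (\<lambda>x y z. lift3 scale fscale (\<lambda>x' y' z'. tensor3 scale (x * x') (y * y') (z * z')) t) s"

text \<open>\<open>t \<mapsto> t \<otimes> z\<close> and \<open>t \<mapsto> x \<otimes> t\<close> as maps from \<open>V \<otimes> V\<close> to \<open>V \<otimes> V \<otimes> V\<close>.\<close>

definition tensor_right :: "('k::field \<Rightarrow> 'a::ab_group_add \<Rightarrow> 'a) \<Rightarrow>
    ('a, 'k) tensor2 \<Rightarrow> 'a \<Rightarrow> ('a, 'k) tensor3" where
  "tensor_right scale t z = lift2 scale fscale (\<lambda>x y. tensor3 scale x y z) t"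

definition tensor_left :: "('k::field \<Rightarrow> 'a::ab_group_add \<Rightarrow> 'a) \<Rightarrow>
    'a \<Rightarrow> ('a, 'k) tensor2 \<Rightarrow> ('a, 'k) tensor3" where
  "tensor_left scale x t = lift2 scale fscale (\<lambda>y z. tensor3 scale x y z) t"

text \<open>\<open>\<Delta> \<otimes> id\<close> and \<open>id \<otimes> \<Delta>\<close>.\<close>

definition comult_id :: "('k::field \<Rightarrow> 'a::ab_group_add \<Rightarrow> 'a) \<Rightarrow>
    ('a \<Rightarrow> ('a, 'k) tensor2) \<Rightarrow> ('a, 'k) tensor2 \<Rightarrow> ('a, 'k) tensor3" where
  "comult_id scale \<Delta> = lift2 scale fscale (\<lambda>x y. tensor_right scale (\<Delta> x) y)"

definition id_comult :: "('k::field \<Rightarrow> 'a::ab_group_add \<Rightarrow> 'a) \<Rightarrow>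
    ('a \<Rightarrow> ('a, 'k) tensor2) \<Rightarrow> ('a, 'k) tensor2 \<Rightarrow> ('a, 'k) tensor3" where
  "id_comult scale \<Delta> = lift2 scale fscale (\<lambda>x y. tensor_left scale x (\<Delta> y))"

context k_algebra
begin

lemma linear_mult_left: "Vector_Spaces.linear scale scale (\<lambda>x. a * x)"
  by (rule linearI) (auto simp: vector_space_axioms algebra_simps scale_mult_right)

lemma linear_mult_right: "Vector_Spaces.linear scale scale (\<lambda>x. x * a)"
  by (rule linearI) (auto simp: vector_space_axioms algebra_simps scale_mult_left)

lemma tensor2_mult_tensor2:
  "tensor2_mult scale (tensor2 scale x y) (tensor2 scale x' y') = tensor2 scale (x * x') (y * y')"
proof -
  note t = bilinear_tensor2[OF vector_space_axioms, unfolded bilinear_map_def]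
  have 1: "bilinear_map scale fscale (\<lambda>x' y'. tensor2 scale (x * x') (y * y'))" for x y
    using t linear_comp[OF linear_mult_left, of fscale] by (auto simp: bilinear_map_def)
  have 2: "bilinear_map scale fscale (\<lambda>x y. tensor2 scale (x * x') (y * y'))" for x' y'
    using t linear_comp[OF linear_mult_right, of fscale] by (auto simp: bilinear_map_def)
  show ?thesis
    unfolding tensor2_mult_def lift2(2)[OF 1] lift2(2)[OF 2] ..
qed

lemma tensor3_mult_tensor3:
  "tensor3_mult scale (tensor3 scale x y z) (tensor3 scale x' y' z') =
     tensor3 scale (x * x') (y * y') (z * z')"
proof -
  note t = trilinear_tensor3[OF vector_space_axioms, unfolded trilinear_map_def]
  have 1: "trilinear_map scale fscale (\<lambda>x' y' z'. tensor3 scale (x * x') (y * y') (z * z'))" for x y z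
    using t linear_comp[OF linear_mult_left, of fscale "\<lambda>x. tensor3 scale x u w" for u w]
      linear_comp[OF linear_mult_left, of fscale "\<lambda>z. tensor3 scale u w z" for u w]
      linear_comp[OF linear_mult_left, of fscale "\<lambda>y. tensor3 scale u y w" for u w]
    by (auto simp: trilinear_map_def)
  have 2: "trilinear_map scale fscale (\<lambda>x y z. tensor3 scale (x * x') (y * y') (z * z'))" for x' y' z'
    using t linear_comp[OF linear_mult_right, of fscale "\<lambda>x. tensor3 scale x u w" for u w]
      linear_comp[OF linear_mult_right, of fscale "\<lambda>z. tensor3 scale u w z" for u w]
      linear_comp[OF linear_mult_right, of fscale "\<lambda>y. tensor3 scale u y w" for u w]
    by (auto simp: trilinear_map_def)
  show ?thesis
    unfolding tensor3_mult_def lift3(2)[OF 1] lift3(2)[OF 2] ..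
qed

end

text \<open>
  The multiplication and the unit are those of the ring type, with \<open>\<eta> c = scale c 1\<close>.
  In the counit laws \<open>K \<otimes> V\<close> and \<open>V \<otimes> K\<close> are identified with \<open>V\<close>.
\<close>

locale weak_bialgebra = k_algebra scale
  for scale :: "'k::field \<Rightarrow> 'a::ring_1 \<Rightarrow> 'a" +
  fixes \<Delta> :: "'a \<Rightarrow> ('a, 'k) tensor2" and \<epsilon> :: "'a \<Rightarrow> 'k"
  assumes comult_in: "\<Delta> x \<in> tensor_space2 scale"
    and comult_linear: "Vector_Spaces.linear scale fscale \<Delta>"
    and counit_linear: "Vector_Spaces.linear scale (*) \<epsilon>"
    and coassoc: "comult_id scale \<Delta> (\<Delta> x) = id_comult scale \<Delta> (\<Delta> x)"
    and counit_left: "lift2 scale scale (\<lambda>u v. scale (\<epsilon> u) v) (\<Delta> x) = x"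
    and counit_right: "lift2 scale scale (\<lambda>u v. scale (\<epsilon> v) u) (\<Delta> x) = x"
    and comult_mult: "\<Delta> (x * y) = tensor2_mult scale (\<Delta> x) (\<Delta> y)"
    and comult_one_left: "comult_id scale \<Delta> (\<Delta> 1) =
      tensor3_mult scale (tensor_right scale (\<Delta> 1) 1) (tensor_left scale 1 (\<Delta> 1))"
    and comult_one_right: "comult_id scale \<Delta> (\<Delta> 1) =
      tensor3_mult scale (tensor_left scale 1 (\<Delta> 1)) (tensor_right scale (\<Delta> 1) 1)"
    and counit_mult: "\<epsilon> (x * y * z) = lift2 scale (*) (\<lambda>u v. \<epsilon> (x * u) * \<epsilon> (v * z)) (\<Delta> y)"

text \<open>
  If a basis of a subalgebra consists of group-like elements of counit 1, then in a weak bialgebra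
  the basis itself must be closed under multiplication; it is not enough that its span is.
  For instance \<open>f * f = 2 f\<close> would give \<open>2 (f \<otimes> f) = \<Delta> (f * f) = 4 (f \<otimes> f)\<close>.
\<close>

lemma (in weak_bialgebra) grouplike_basis_closed:
  assumes S: "independent S" and grouplike: "\<And>f. f \<in> S \<Longrightarrow> \<Delta> f = tensor2 scale f f"
    and counit: "\<And>f. f \<in> S \<Longrightarrow> \<epsilon> f = 1"
    and h: "\<Delta> h = tensor2 scale h h" "\<And>f. f \<in> S \<Longrightarrow> h * f = f \<and> f * h = f"
    and f: "f \<in> S" and g: "g \<in> S" and fg: "f * g \<in> span S"
  shows "f * g \<in> S"
proof -
  define B where "B = extend_basis S"
  define r where "r = representation B"
  have B: "independent B" "span B = UNIV" "S \<subseteq> B"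
    using independent_extend_basis[OF S] span_extend_basis[OF S] extend_basis_superset[OF S]
    by (simp_all add: B_def)
  have r: "Vector_Spaces.linear scale (*) (\<lambda>x. r x b)" for b
    by (rule linearI)
       (auto simp: r_def vector_space_axioms vector_space_mult representation_add representation_scale B)
  have bil: "bilinear_map scale (*) (\<lambda>x y. r x b * r y c)" for b c
    unfolding bilinear_map_def using linear_mult_const[OF r] by blast
  have bil': "bilinear_map scale (*) (\<lambda>u v. \<epsilon> (x * u) * \<epsilon> (v * z))" for x z
    unfolding bilinear_map_def
    using linear_mult_const[OF linear_comp[OF linear_mult_left counit_linear]]
      linear_mult_const[OF linear_comp[OF linear_mult_right counit_linear]] by blast
  let ?x = "f * g"
  have "\<epsilon> (f * h * g) = \<epsilon> (f * h) * \<epsilon> (h * g)"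
    unfolding counit_mult h(1) lift2(2)[OF bil'] ..
  then have "\<epsilon> ?x = 1" using h(2) f g counit by simp
  then have "?x \<noteq> 0" using linearD(2)[OF counit_linear, of 0 0] by auto
  have \<Delta>x: "\<Delta> ?x = tensor2 scale ?x ?x"
    by (simp add: comult_mult grouplike f g tensor2_mult_tensor2)
  have rS: "r c b = (if b = c then 1 else 0)" if "c \<in> S" for b c
    using that B by (auto simp: r_def representation_basis)
  have eq: "r ?x b * r ?x c = (if b = c then r ?x b else 0)" for b c
  proof -
    let ?D = "\<lambda>x y. r x b * r y c"
    have l1: "Vector_Spaces.linear scale (*) (\<lambda>y. \<Delta> y ?D)"
      by (rule linearI)
         (auto simp: vector_space_axioms vector_space_mult linearD[OF comult_linear] fscale_def)
    have l2: "Vector_Spaces.linear scale (*) (\<lambda>y. if b = c then r y b else 0)"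
      using r[of b] by (auto simp: Vector_Spaces.linear_iff)
    have "\<Delta> ?x ?D = (if b = c then r ?x b else 0)"
      by (rule linear_eqI_span[OF l1 l2 fg]) (auto simp: grouplike tensor2_def bil rS)
    then show ?thesis by (simp add: \<Delta>x tensor2_def bil)
  qed
  have x: "(\<Sum>b | r ?x b \<noteq> 0. scale (r ?x b) b) = ?x"
    unfolding r_def by (rule sum_nonzero_representation_eq) (use B in auto)
  then obtain b where b: "r ?x b \<noteq> 0"
    using \<open>?x \<noteq> 0\<close> by (metis (mono_tags, lifting) empty_Collect_eq sum.empty)
  then have b1: "r ?x b = 1" using eq[of b b] by simp
  have "{b. r ?x b \<noteq> 0} = {b}"
    using b eq[of b] by (metis (mono_tags, lifting) Collect_cong mult_eq_0_iff singleton_conv)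
  with x b1 have "?x = b" by simp
  moreover have "b \<in> S"
  proof (rule ccontr)
    assume "b \<notin> S"
    have "r ?x b = 0"
      by (rule linear_eqI_span[OF r _ fg, where g = "\<lambda>_. 0"])
         (use \<open>b \<notin> S\<close> in \<open>auto simp: rS Vector_Spaces.linear_iff vector_space_axioms vector_space_mult\<close>)
    with b show False by simp
  qed
  ultimately show ?thesis by simp
qed

end

theory Submission
  imports Defs
begin

text \<open>
  The idea is to replace the basis by group-like elements. Put \<open>g\<^sub>i = e\<^sub>i - e\<^sub>i\<^sub>+\<^sub>1\<close> for \<open>i < p\<close> and
  \<open>g\<^sub>p = e\<^sub>p\<close>. The definitions of \<open>\<Delta>\<close> and \<open>\<epsilon>\<close> say exactly that \<open>\<Delta> g\<^sub>i = g\<^sub>i \<otimes> g\<^sub>i\<close> and \<open>\<epsilon> g\<^sub>i = 1\<close>,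
  and since \<open>e\<^sub>k = g\<^sub>k + \<dots> + g\<^sub>p\<close>, the set \<open>G = {g\<^sub>1, \<dots>, g\<^sub>p} \<union> \<bb>\<^sub>2\<close> of group-like elements still
  spans the algebra. The multiplication becomes simple as well: the \<open>g\<^sub>i\<close> are orthogonal
  idempotents with sum \<open>e\<^sub>1 = 1\<close>, the \<open>g\<^sub>i\<close> with \<open>i < p\<close> annihilate \<open>\<bb>\<^sub>2\<close>, and \<open>M = {g\<^sub>p} \<union> \<bb>\<^sub>2\<close> is
  closed under multiplication. So \<open>G \<union> {0}\<close> is a semigroup.

  All axioms are multilinear, hence need to be checked on \<open>G\<close> only. There coassociativity and the
  counit laws are immediate, \<open>\<Delta>\<close> is multiplicative because a product in \<open>G \<union> {0}\<close> is group-like or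
  zero, and the axiom for \<open>\<epsilon> (x y z)\<close> says that \<open>x y z\<close> vanishes only if \<open>x y\<close> or \<open>y z\<close> does.
  The axiom for \<open>\<Delta> 1\<close> holds because \<open>\<Sum>\<^sub>i\<^sub>j g\<^sub>i \<otimes> g\<^sub>i g\<^sub>j \<otimes> g\<^sub>j = \<Sum>\<^sub>i g\<^sub>i \<otimes> g\<^sub>i \<otimes> g\<^sub>i\<close>.
  This argument is \<open>weak_bialgebra_of_grouplike_span\<close>; the theorem is an instance.
\<close>

section \<open>Linear dependence of lifted maps on parameters\<close>

lemma linear_add:
  assumes "Vector_Spaces.linear s1 s2 f" "Vector_Spaces.linear s1 s2 g"
  shows "Vector_Spaces.linear s1 s2 (\<lambda>x. f x + g x)"
proof -
  interpret W: vector_space s2 using assms(1) by (rule linearD)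
  show ?thesis using assms by (auto simp: Vector_Spaces.linear_iff W.scale_right_distrib)
qed

lemma linear_scale:
  assumes "Vector_Spaces.linear s1 s2 f"
  shows "Vector_Spaces.linear s1 s2 (\<lambda>x. s2 c (f x))"
proof -
  interpret W: vector_space s2 using assms(1) by (rule linearD)
  show ?thesis using assms
    by (auto simp: Vector_Spaces.linear_iff W.scale_right_distrib mult.commute)
qed

lemma linear_sum:
  assumes "Vector_Spaces.linear s1 s2 f"
  shows "f (\<Sum>i\<in>I. g i) = (\<Sum>i\<in>I. f (g i))"
  using assms unfolding Vector_Spaces.linear_iff_module_hom by (rule module_hom.sum)

lemma linear_zero:
  assumes "Vector_Spaces.linear s1 s2 f"
  shows "f 0 = 0"
  using assms unfolding Vector_Spaces.linear_iff_module_hom by (rule module_hom.zero)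

lemma linear_diff:
  assumes "Vector_Spaces.linear s1 s2 f"
  shows "f (x - y) = f x - f y"
  using assms unfolding Vector_Spaces.linear_iff_module_hom by (rule module_hom.diff)

lemma linear_in_span:
  assumes "Vector_Spaces.linear s1 s2 f" and x: "x \<in> module.span s1 S"
    and T: "\<And>b. b \<in> S \<Longrightarrow> f b \<in> module.span s2 T"
  shows "f x \<in> module.span s2 T"
proof -
  interpret vector_space_pair s1 s2
    using assms(1) by (auto simp: vector_space_pair_def dest: linearD)
  have "f x \<in> vs2.span (f ` S)"
    using x by (simp add: linear_span_image[OF assms(1)])
  also have "\<dots> \<subseteq> vs2.span T"
    using T by (intro vs2.span_minimal) auto
  finally show ?thesis .
qed

text \<open>
  Since \<open>lift2\<close> picks some linear extension, it depends linearly on the bilinear map only where the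
  extension is determined, that is, on \<open>V \<otimes> V\<close>.
\<close>

lemma lift2_linear_param:
  assumes \<beta>: "\<And>x. bilinear_map scale sW (\<beta> x)"
    and lin: "\<And>u v. Vector_Spaces.linear sX sW (\<lambda>x. \<beta> x u v)"
    and t: "t \<in> tensor_space2 scale"
  shows "Vector_Spaces.linear sX sW (\<lambda>x. lift2 scale sW (\<beta> x) t)"
proof (rule linearI)
  note l = lift2(1)[OF \<beta>]
  show "lift2 scale sW (\<beta> (x + y)) t = lift2 scale sW (\<beta> x) t + lift2 scale sW (\<beta> y) t" for x y
    by (rule linear_eqI_span[OF l linear_add[OF l l] t[unfolded tensor_space2_def]])
       (auto simp: lift2(2)[OF \<beta>] linearD(1)[OF lin])
  show "lift2 scale sW (\<beta> (sX c x)) t = sW c (lift2 scale sW (\<beta> x) t)" for c x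
    by (rule linear_eqI_span[OF l linear_scale[OF l] t[unfolded tensor_space2_def]])
       (auto simp: lift2(2)[OF \<beta>] linearD(2)[OF lin])
qed (use linearD(3,4)[OF lin] in auto)

lemma lift3_linear_param:
  assumes \<beta>: "\<And>x. trilinear_map scale sW (\<beta> x)"
    and lin: "\<And>u v w. Vector_Spaces.linear sX sW (\<lambda>x. \<beta> x u v w)"
    and t: "t \<in> tensor_space3 scale"
  shows "Vector_Spaces.linear sX sW (\<lambda>x. lift3 scale sW (\<beta> x) t)"
proof (rule linearI)
  note l = lift3(1)[OF \<beta>]
  show "lift3 scale sW (\<beta> (x + y)) t = lift3 scale sW (\<beta> x) t + lift3 scale sW (\<beta> y) t" for x y
    by (rule linear_eqI_span[OF l linear_add[OF l l] t[unfolded tensor_space3_def]])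
       (auto simp: lift3(2)[OF \<beta>] linearD(1)[OF lin])
  show "lift3 scale sW (\<beta> (sX c x)) t = sW c (lift3 scale sW (\<beta> x) t)" for c x
    by (rule linear_eqI_span[OF l linear_scale[OF l] t[unfolded tensor_space3_def]])
       (auto simp: lift3(2)[OF \<beta>] linearD(2)[OF lin])
qed (use linearD(3,4)[OF lin] in auto)


section \<open>Linearity of the operations on tensor powers\<close>

context k_algebra
begin

lemmas tensor2_linear = bilinear_tensor2[OF vector_space_axioms, unfolded bilinear_map_def]
lemmas tensor3_linear = trilinear_tensor3[OF vector_space_axioms, unfolded trilinear_map_def]

lemma linear_tensor2_times:
  "Vector_Spaces.linear scale fscale (\<lambda>x. tensor2 scale (x * a) v)"
  "Vector_Spaces.linear scale fscale (\<lambda>x. tensor2 scale (a * x) v)"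
  "Vector_Spaces.linear scale fscale (\<lambda>y. tensor2 scale u (y * a))"
  "Vector_Spaces.linear scale fscale (\<lambda>y. tensor2 scale u (a * y))"
  using tensor2_linear
  by (auto intro: linear_comp[OF linear_mult_right, where g = "\<lambda>x. tensor2 scale x v"]
      linear_comp[OF linear_mult_left, where g = "\<lambda>x. tensor2 scale x v"]
      linear_comp[OF linear_mult_right, where g = "\<lambda>y. tensor2 scale u y"]
      linear_comp[OF linear_mult_left, where g = "\<lambda>y. tensor2 scale u y"])

lemma linear_tensor3_times:
  "Vector_Spaces.linear scale fscale (\<lambda>x. tensor3 scale (x * a) v w)"
  "Vector_Spaces.linear scale fscale (\<lambda>x. tensor3 scale (a * x) v w)"
  "Vector_Spaces.linear scale fscale (\<lambda>y. tensor3 scale u (y * a) w)"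
  "Vector_Spaces.linear scale fscale (\<lambda>y. tensor3 scale u (a * y) w)"
  "Vector_Spaces.linear scale fscale (\<lambda>z. tensor3 scale u v (z * a))"
  "Vector_Spaces.linear scale fscale (\<lambda>z. tensor3 scale u v (a * z))"
  using tensor3_linear
  by (auto intro: linear_comp[OF linear_mult_right, where g = "\<lambda>x. tensor3 scale x v w"]
      linear_comp[OF linear_mult_left, where g = "\<lambda>x. tensor3 scale x v w"]
      linear_comp[OF linear_mult_right, where g = "\<lambda>y. tensor3 scale u y w"]
      linear_comp[OF linear_mult_left, where g = "\<lambda>y. tensor3 scale u y w"]
      linear_comp[OF linear_mult_right, where g = "\<lambda>z. tensor3 scale u v z"]
      linear_comp[OF linear_mult_left, where g = "\<lambda>z. tensor3 scale u v z"])

lemma bilinear_tensor2_times: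
  "bilinear_map scale fscale (\<lambda>x' y'. tensor2 scale (x * x') (y * y'))"
  unfolding bilinear_map_def by (intro conjI allI linear_tensor2_times)

lemma trilinear_tensor3_times:
  "trilinear_map scale fscale (\<lambda>x' y' z'. tensor3 scale (x * x') (y * y') (z * z'))"
  unfolding trilinear_map_def by (intro conjI allI linear_tensor3_times)

text \<open>
  The product of two tensors is a nested lift. Its outer lift has the universal property only once
  the inner one is known to be multilinear, and that depends on the second factor being a
  tensor, not an arbitrary functional on multilinear forms.
\<close>

lemma bilinear_tensor2_mult_lift:
  assumes "t \<in> tensor_space2 scale"
  shows "bilinear_map scale fscale
    (\<lambda>x y. lift2 scale fscale (\<lambda>x' y'. tensor2 scale (x * x') (y * y')) t)"
  unfolding bilinear_map_def
  by (intro conjI allI lift2_linear_param bilinear_tensor2_times linear_tensor2_times assms)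

lemma trilinear_tensor3_mult_lift:
  assumes "t \<in> tensor_space3 scale"
  shows "trilinear_map scale fscale
    (\<lambda>x y z. lift3 scale fscale (\<lambda>x' y' z'. tensor3 scale (x * x') (y * y') (z * z')) t)"
  unfolding trilinear_map_def
  by (intro conjI allI lift3_linear_param trilinear_tensor3_times linear_tensor3_times assms)

lemma linear_tensor2_mult_left:
  assumes "t \<in> tensor_space2 scale"
  shows "Vector_Spaces.linear fscale fscale (\<lambda>s. tensor2_mult scale s t)"
  unfolding tensor2_mult_def by (rule lift2(1)[OF bilinear_tensor2_mult_lift[OF assms]])

lemma linear_tensor3_mult_left:
  assumes "t \<in> tensor_space3 scale"
  shows "Vector_Spaces.linear fscale fscale (\<lambda>s. tensor3_mult scale s t)"
  unfolding tensor3_mult_def by (rule lift3(1)[OF trilinear_tensor3_mult_lift[OF assms]])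

lemma tensor2_mult_pure_left:
  assumes "t \<in> tensor_space2 scale"
  shows "tensor2_mult scale (tensor2 scale x y) t =
    lift2 scale fscale (\<lambda>x' y'. tensor2 scale (x * x') (y * y')) t"
  unfolding tensor2_mult_def by (rule lift2(2)[OF bilinear_tensor2_mult_lift[OF assms]])

lemma tensor3_mult_pure_left:
  assumes "t \<in> tensor_space3 scale"
  shows "tensor3_mult scale (tensor3 scale x y z) t =
    lift3 scale fscale (\<lambda>x' y' z'. tensor3 scale (x * x') (y * y') (z * z')) t"
  unfolding tensor3_mult_def by (rule lift3(2)[OF trilinear_tensor3_mult_lift[OF assms]])

lemma tensor2_in_space: "tensor2 scale x y \<in> tensor_space2 scale"
  unfolding tensor_space2_def
proof -
  interpret F: vector_space "fscale :: 'k \<Rightarrow> (('a \<Rightarrow> 'a \<Rightarrow> 'k) \<Rightarrow> 'k) \<Rightarrow> ('a \<Rightarrow> 'a \<Rightarrow> 'k) \<Rightarrow> 'k"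
    by (rule vector_space_fscale)
  show "tensor2 scale x y \<in> F.span {tensor2 scale x y | x y. True}"
    by (rule F.span_base) auto
qed

lemma tensor3_sum_in_space: "(\<Sum>i\<in>I. tensor3 scale (a i) (b i) (c i)) \<in> tensor_space3 scale"
proof -
  interpret F: vector_space "fscale :: 'k \<Rightarrow> (('a \<Rightarrow> 'a \<Rightarrow> 'a \<Rightarrow> 'k) \<Rightarrow> 'k) \<Rightarrow> ('a \<Rightarrow> 'a \<Rightarrow> 'a \<Rightarrow> 'k) \<Rightarrow> 'k"
    by (rule vector_space_fscale)
  show ?thesis unfolding tensor_space3_def by (intro F.span_sum F.span_base) auto
qed

lemma tensor3_mult_sum:
  "tensor3_mult scale (\<Sum>i\<in>I. tensor3 scale (a i) (b i) (c i))
      (\<Sum>j\<in>J. tensor3 scale (a' j) (b' j) (c' j)) =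
    (\<Sum>i\<in>I. \<Sum>j\<in>J. tensor3 scale (a i * a' j) (b i * b' j) (c i * c' j))"
  by (simp add: linear_sum[OF linear_tensor3_mult_left] tensor3_sum_in_space
      tensor3_mult_pure_left linear_sum[OF lift3(1)[OF trilinear_tensor3_times]]
      lift3(2)[OF trilinear_tensor3_times])

lemma bilinear_tensor3_right: "bilinear_map scale fscale (\<lambda>x y. tensor3 scale x y z)"
  and bilinear_tensor3_left: "bilinear_map scale fscale (\<lambda>y z. tensor3 scale x y z)"
  using tensor3_linear by (auto simp: bilinear_map_def)

lemma tensor_right_linear:
  "Vector_Spaces.linear fscale fscale (\<lambda>t. tensor_right scale t z)"
  "tensor_right scale (tensor2 scale x y) z = tensor3 scale x y z"
  "t \<in> tensor_space2 scale \<Longrightarrow> Vector_Spaces.linear scale fscale (\<lambda>z. tensor_right scale t z)"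
  unfolding tensor_right_def
  using lift2[OF bilinear_tensor3_right] tensor3_linear
  by (auto intro!: lift2_linear_param bilinear_tensor3_right)

lemma tensor_left_linear:
  "Vector_Spaces.linear fscale fscale (\<lambda>t. tensor_left scale x t)"
  "tensor_left scale x (tensor2 scale y z) = tensor3 scale x y z"
  "t \<in> tensor_space2 scale \<Longrightarrow> Vector_Spaces.linear scale fscale (\<lambda>x. tensor_left scale x t)"
  unfolding tensor_left_def
  using lift2[OF bilinear_tensor3_left] tensor3_linear
  by (auto intro!: lift2_linear_param bilinear_tensor3_left)


section \<open>Weak bialgebras spanned by group-like elements\<close>

text \<open>
  Here \<open>G \<union> {0}\<close> is a multiplicative semigroup. If \<open>x\<close>, \<open>y\<close>, \<open>z\<close> lie in \<open>G\<close>, then \<open>\<epsilon>\<close> takes the value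
  1 or 0 on \<open>x y z\<close>, according to whether the product is nonzero; hence \<open>mult3_0\<close> is
  the axiom \<open>\<epsilon> (x y z) = \<epsilon> (x y) \<epsilon> (y z)\<close>. The unit need only be a sum of orthogonal
  idempotents from \<open>G\<close>; when there is a single summand, it lies in \<open>G\<close>, and one recovers the
  bialgebra structure of a monoid algebra.
\<close>

theorem weak_bialgebra_of_grouplike_span:
  fixes \<Delta> :: "'a \<Rightarrow> ('a, 'k) tensor2" and \<epsilon> :: "'a \<Rightarrow> 'k" and h :: "'i \<Rightarrow> 'a"
  assumes G: "span G = UNIV"
    and comult_linear: "Vector_Spaces.linear scale fscale \<Delta>"
    and counit_linear: "Vector_Spaces.linear scale (*) \<epsilon>"
    and grouplike: "\<And>g. g \<in> G \<Longrightarrow> \<Delta> g = tensor2 scale g g"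
    and counit: "\<And>g. g \<in> G \<Longrightarrow> \<epsilon> g = 1"
    and mult2: "\<And>x y. x \<in> G \<Longrightarrow> y \<in> G \<Longrightarrow> x * y \<in> insert 0 G"
    and mult3_0: "\<And>x y z. x \<in> G \<Longrightarrow> y \<in> G \<Longrightarrow> z \<in> G \<Longrightarrow> x * y * z = 0 \<Longrightarrow> x * y = 0 \<or> y * z = 0"
    and I: "finite I" "\<And>i. i \<in> I \<Longrightarrow> h i \<in> G"
    and one: "1 = (\<Sum>i\<in>I. h i)"
    and orth: "\<And>i j. i \<in> I \<Longrightarrow> j \<in> I \<Longrightarrow> h i * h j = (if i = j then h i else 0)"
  shows "weak_bialgebra scale \<Delta> \<epsilon>"
proof (intro weak_bialgebra.intro weak_bialgebra_axioms.intro k_algebra_axioms)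
  note eqI = linear_eqI_span[where sV = scale and B = G, unfolded G, OF _ _ UNIV_I]
  have zero: "\<epsilon> 0 = 0" "\<Delta> 0 = 0" "tensor2 scale 0 0 = 0"
    using linear_zero[OF counit_linear] linear_zero[OF comult_linear]
      linear_zero[of scale fscale "\<lambda>x. tensor2 scale x 0"] tensor2_linear
    by auto
  have comult0: "\<Delta> x = tensor2 scale x x" if "x \<in> insert 0 G" for x
    using that by (auto simp: grouplike zero)
  have counit0: "\<epsilon> x = (if x = 0 then 0 else 1)" if "x \<in> insert 0 G" for x
    using that counit zero by auto

  show in_space: "\<Delta> x \<in> tensor_space2 scale" for x
    unfolding tensor_space2_def
    by (rule linear_in_span[OF comult_linear, where S = G], simp add: G)
       (simp only: grouplike, rule tensor2_in_space[unfolded tensor_space2_def])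
  show "Vector_Spaces.linear scale fscale \<Delta>" "Vector_Spaces.linear scale (*) \<epsilon>" by fact+

  have bil_l: "bilinear_map scale fscale (\<lambda>x y. tensor_right scale (\<Delta> x) y)"
    unfolding bilinear_map_def
    by (intro conjI allI tensor_right_linear(3) in_space
        linear_comp[OF comult_linear tensor_right_linear(1)])
  have bil_r: "bilinear_map scale fscale (\<lambda>x y. tensor_left scale x (\<Delta> y))"
    unfolding bilinear_map_def
    by (intro conjI allI tensor_left_linear(3) in_space
        linear_comp[OF comult_linear tensor_left_linear(1)])
  note cl = lift2[OF bil_l, folded comult_id_def]
  note cr = lift2[OF bil_r, folded id_comult_def]
  show "comult_id scale \<Delta> (\<Delta> x) = id_comult scale \<Delta> (\<Delta> x)" for x
    by (rule eqI[OF linear_comp[OF comult_linear cl(1)] linear_comp[OF comult_linear cr(1)]])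
       (simp add: grouplike cl(2) cr(2) tensor_right_linear tensor_left_linear)

  have id: "Vector_Spaces.linear scale scale (\<lambda>x. x)"
    by (simp add: Vector_Spaces.linear_iff vector_space_axioms)
  have scale1: "Vector_Spaces.linear scale scale (\<lambda>u. scale (\<epsilon> u) v)" for v
    by (rule linearI) (auto simp: vector_space_axioms linearD[OF counit_linear] scale_left_distrib)
  have scale2: "Vector_Spaces.linear scale scale (\<lambda>v. scale (\<epsilon> u) v)" for u
    by (rule linear_scale[OF id])
  have bil_el: "bilinear_map scale scale (\<lambda>u v. scale (\<epsilon> u) v)"
    and bil_er: "bilinear_map scale scale (\<lambda>u v. scale (\<epsilon> v) u)"
    unfolding bilinear_map_def using scale1 scale2 by blast+
  show "lift2 scale scale (\<lambda>u v. scale (\<epsilon> u) v) (\<Delta> x) = x" for x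
    by (rule eqI[OF linear_comp[OF comult_linear lift2(1)[OF bil_el]] id])
       (simp add: grouplike lift2(2)[OF bil_el] counit)
  show "lift2 scale scale (\<lambda>u v. scale (\<epsilon> v) u) (\<Delta> x) = x" for x
    by (rule eqI[OF linear_comp[OF comult_linear lift2(1)[OF bil_er]] id])
       (simp add: grouplike lift2(2)[OF bil_er] counit)

  show "\<Delta> (x * y) = tensor2_mult scale (\<Delta> x) (\<Delta> y)" for x y
  proof (rule eqI[where x = x])
    show "Vector_Spaces.linear scale fscale (\<lambda>x. \<Delta> (x * y))"
      by (rule linear_comp[OF linear_mult_right comult_linear])
    show "Vector_Spaces.linear scale fscale (\<lambda>x. tensor2_mult scale (\<Delta> x) (\<Delta> y))"
      by (rule linear_comp[OF comult_linear linear_tensor2_mult_left[OF in_space]])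
    show "\<Delta> (g * y) = tensor2_mult scale (\<Delta> g) (\<Delta> y)" if g: "g \<in> G" for g
    proof -
      note l = lift2[OF bilinear_tensor2_times]
      have "\<Delta> (g * y) = lift2 scale fscale (\<lambda>x' y'. tensor2 scale (g * x') (g * y')) (\<Delta> y)"
        by (rule eqI[OF linear_comp[OF linear_mult_left comult_linear]
              linear_comp[OF comult_linear l(1)]])
           (simp add: l(2) grouplike comult0[OF mult2[OF g]])
      then show ?thesis by (simp add: grouplike g tensor2_mult_pure_left in_space)
    qed
  qed

  have comult1: "\<Delta> 1 = (\<Sum>i\<in>I. tensor2 scale (h i) (h i))"
    unfolding one by (simp add: linear_sum[OF comult_linear] grouplike I)
  have right: "tensor_right scale (\<Delta> 1) 1 = (\<Sum>i\<in>I. tensor3 scale (h i) (h i) 1)"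
    and left: "tensor_left scale 1 (\<Delta> 1) = (\<Sum>i\<in>I. tensor3 scale 1 (h i) (h i))"
    unfolding comult1 linear_sum[OF tensor_right_linear(1)] linear_sum[OF tensor_left_linear(1)]
    by (simp_all only: tensor_right_linear(2) tensor_left_linear(2))
  have diag: "comult_id scale \<Delta> (\<Delta> 1) = (\<Sum>i\<in>I. tensor3 scale (h i) (h i) (h i))"
    unfolding comult1 linear_sum[OF cl(1)]
    by (simp add: cl(2) grouplike I tensor_right_linear(2))
  have zero3: "tensor3 scale x 0 z = 0" for x z
    using linear_zero[of scale fscale "\<lambda>y. tensor3 scale x y z"] tensor3_linear by auto
  \<comment> \<open>The two orders of multiplication give \<open>\<Sum>\<^sub>i\<^sub>j h\<^sub>i \<otimes> h\<^sub>i h\<^sub>j \<otimes> h\<^sub>j\<close> and \<open>\<Sum>\<^sub>i\<^sub>j h\<^sub>j \<otimes> h\<^sub>i h\<^sub>j \<otimes> h\<^sub>i\<close>,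
    whose off-diagonal terms vanish in the middle factor.\<close>
  have off: "tensor3 scale (h i) (h i * h j) (h j) =
      (if i = j then tensor3 scale (h i) (h i) (h i) else 0)"
    "tensor3 scale (h j) (h i * h j) (h i) =
      (if i = j then tensor3 scale (h i) (h i) (h i) else 0)"
    if "i \<in> I" "j \<in> I" for i j
    using that by (auto simp: orth zero3)
  show "comult_id scale \<Delta> (\<Delta> 1) =
      tensor3_mult scale (tensor_right scale (\<Delta> 1) 1) (tensor_left scale 1 (\<Delta> 1))"
    unfolding right left diag tensor3_mult_sum using I(1) by (simp add: off)
  show "comult_id scale \<Delta> (\<Delta> 1) =
      tensor3_mult scale (tensor_left scale 1 (\<Delta> 1)) (tensor_right scale (\<Delta> 1) 1)"
    unfolding right left diag tensor3_mult_sum using I(1) by (simp add: off)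

  have lin_l: "Vector_Spaces.linear scale (*) (\<lambda>u. \<epsilon> (x * u) * c)"
    "Vector_Spaces.linear scale (*) (\<lambda>u. \<epsilon> (u * x) * c)"
    "Vector_Spaces.linear scale (*) (\<lambda>u. c * \<epsilon> (x * u))"
    "Vector_Spaces.linear scale (*) (\<lambda>u. c * \<epsilon> (u * x))" for x c
    by (intro linear_mult_const linear_comp[OF linear_mult_left counit_linear]
        linear_comp[OF linear_mult_right counit_linear])+
  have bil: "bilinear_map scale (*) (\<lambda>u v. \<epsilon> (x * u) * \<epsilon> (v * z))" for x z
    unfolding bilinear_map_def by (intro conjI allI lin_l)
  show "\<epsilon> (x * y * z) = lift2 scale (*) (\<lambda>u v. \<epsilon> (x * u) * \<epsilon> (v * z)) (\<Delta> y)" for x y z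
  proof (rule eqI[where x = x])
    show "Vector_Spaces.linear scale (*) (\<lambda>x. \<epsilon> (x * y * z))"
      using linear_comp[OF linear_mult_right counit_linear, of "y * z"] by (simp add: mult.assoc)
    show "Vector_Spaces.linear scale (*) (\<lambda>x. lift2 scale (*) (\<lambda>u v. \<epsilon> (x * u) * \<epsilon> (v * z)) (\<Delta> y))"
      by (intro lift2_linear_param bil lin_l in_space)
    show "\<epsilon> (a * y * z) = lift2 scale (*) (\<lambda>u v. \<epsilon> (a * u) * \<epsilon> (v * z)) (\<Delta> y)" if a: "a \<in> G" for a
    proof (rule eqI[where x = z])
      show "Vector_Spaces.linear scale (*) (\<lambda>z. \<epsilon> (a * y * z))"
        by (rule linear_comp[OF linear_mult_left counit_linear])
      show "Vector_Spaces.linear scale (*)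
          (\<lambda>z. lift2 scale (*) (\<lambda>u v. \<epsilon> (a * u) * \<epsilon> (v * z)) (\<Delta> y))"
        by (intro lift2_linear_param bil lin_l in_space)
      show "\<epsilon> (a * y * c) = lift2 scale (*) (\<lambda>u v. \<epsilon> (a * u) * \<epsilon> (v * c)) (\<Delta> y)" if c: "c \<in> G" for c
      proof (rule eqI[where x = y])
        show "Vector_Spaces.linear scale (*) (\<lambda>y. \<epsilon> (a * y * c))"
          using linear_comp[OF linear_mult_left linear_comp[OF linear_mult_right counit_linear], of a c]
          by simp
        show "Vector_Spaces.linear scale (*)
            (\<lambda>y. lift2 scale (*) (\<lambda>u v. \<epsilon> (a * u) * \<epsilon> (v * c)) (\<Delta> y))"
          by (rule linear_comp[OF comult_linear lift2(1)[OF bil]])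
        show "\<epsilon> (a * b * c) = lift2 scale (*) (\<lambda>u v. \<epsilon> (a * u) * \<epsilon> (v * c)) (\<Delta> b)"
          if b: "b \<in> G" for b
        proof -
          have "a * b * c \<in> insert 0 G"
            using mult2[OF a b] mult2[OF _ c] by auto
          moreover have "a * b * c = 0 \<longleftrightarrow> a * b = 0 \<or> b * c = 0"
            using mult3_0[OF a b c] mult.assoc[of a b c] by (metis mult_zero_left mult_zero_right)
          ultimately have "\<epsilon> (a * b * c) = \<epsilon> (a * b) * \<epsilon> (b * c)"
            using mult2[OF a b] mult2[OF b c] by (simp add: counit0)
          then show ?thesis by (simp add: grouplike b lift2(2)[OF bil])
        qed
      qed
    qed
  qed
qed

end


section \<open>The group-like spanning set given by a chain of idempotents\<close>

theorem theorem2p7: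
  fixes scale :: "'k::{alg_closed_field, field_char_0} \<Rightarrow> 'a::ring_1 \<Rightarrow> 'a"
    and e :: "nat \<Rightarrow> 'a" and p :: nat and \<bb>\<^sub>1 \<bb>\<^sub>2 :: "'a set"
    and \<Delta> :: "'a \<Rightarrow> ('a, 'k) tensor2" and \<epsilon> :: "'a \<Rightarrow> 'k"
  assumes algebra: "k_algebra scale"
    and basis: "finite_dimensional_vector_space scale (\<bb>\<^sub>1 \<union> \<bb>\<^sub>2)"
    and p: "p \<ge> 1"
    and b1: "\<bb>\<^sub>1 = e ` {1..p}" "inj_on e {1..p}"
    and unit: "e 1 = 1"
    and span_b2: "subalgebra scale (module.span scale \<bb>\<^sub>2)"
    and b2_mult: "\<forall>f\<in>\<bb>\<^sub>2. \<forall>g\<in>\<bb>\<^sub>2. f * g \<in> \<bb>\<^sub>2"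
    and e_e: "\<forall>i\<in>{1..p}. \<forall>j\<in>{1..p}. e i * e j = e (max i j)"
    and e_f: "\<forall>i\<in>{1..p}. \<forall>f\<in>\<bb>\<^sub>2. e i * f = f \<and> f * e i = f"
    and comult_linear: "Vector_Spaces.linear scale fscale \<Delta>"
    and comult_p: "\<Delta> (e p) = tensor2 scale (e p) (e p)"
    and comult_e: "\<forall>i\<in>{1..<p}. \<Delta> (e i) =
      tensor2 scale (e i - e (i + 1)) (e i - e (i + 1)) + \<Delta> (e (i + 1))"
    and comult_f: "\<forall>f\<in>\<bb>\<^sub>2. \<Delta> f = tensor2 scale f f"
    and counit_linear: "Vector_Spaces.linear scale (*) \<epsilon>"
    and counit_e: "\<forall>i\<in>{1..p}. \<epsilon> (e i) = of_nat (p - i + 1)"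
    and counit_f: "\<forall>f\<in>\<bb>\<^sub>2. \<epsilon> f = 1"
  shows "weak_bialgebra scale \<Delta> \<epsilon>"
proof -
  interpret k_algebra scale by (rule algebra)
  define g where "g i = (if i < p then e i - e (i + 1) else e i)" for i
  define M where "M = insert (e p) \<bb>\<^sub>2"
  define G where "G = g ` {1..p} \<union> \<bb>\<^sub>2"

  have e_sum: "e k = (\<Sum>i\<in>{k..p}. g i)" if "k \<le> p" for k
    using that
  proof (induction rule: inc_induct)
    case base
    show ?case by (simp add: g_def)
  next
    case (step k)
    then have "{k..p} = insert k {Suc k..p}" by auto
    with step show ?case by (simp add: g_def)
  qed

  have "\<bb>\<^sub>1 \<union> \<bb>\<^sub>2 \<subseteq> span G"
  proof -
    have "e k \<in> span G" if "k \<in> {1..p}" for k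
      using that by (auto simp: e_sum G_def intro!: span_sum intro: span_base)
    then show ?thesis using b1 by (auto simp: G_def intro: span_base)
  qed
  then have "span (\<bb>\<^sub>1 \<union> \<bb>\<^sub>2) \<subseteq> span G"
    by (rule span_minimal) (rule subspace_span)
  moreover have "span (\<bb>\<^sub>1 \<union> \<bb>\<^sub>2) = UNIV"
    by (rule finite_dimensional_vector_space.span_Basis[OF basis])
  ultimately have G: "span G = UNIV" by auto

  have g_grouplike: "\<Delta> (g i) = tensor2 scale (g i) (g i)" if "i \<in> {1..p}" for i
    using that comult_e comult_p by (cases "i = p") (auto simp: g_def linear_diff[OF comult_linear])
  have g_counit: "\<epsilon> (g i) = 1" if "i \<in> {1..p}" for i
  proof (cases "i = p")
    case False
    then have i: "i \<in> {1..p}" "Suc i \<in> {1..p}" "p - Suc i + 1 = p - i"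
      using that by auto
    have "\<epsilon> (e i) = of_nat (p - i) + 1" "\<epsilon> (e (Suc i)) = of_nat (p - i)"
      using bspec[OF counit_e i(1)] bspec[OF counit_e i(2)] i(3) by simp_all
    then show ?thesis
      using False that by (simp add: g_def linear_diff[OF counit_linear])
  qed (use p counit_e in \<open>auto simp: g_def\<close>)

  have orth: "g i * g j = (if i = j then g i else 0)" if "i \<in> {1..p}" "j \<in> {1..p}" for i j
  proof -
    consider "i = j" | "i < j" | "i = Suc j" | "Suc j < i" by linarith
    then show ?thesis
      using that e_e by cases (auto simp: g_def algebra_simps max_def)
  qed
  have g_b2: "g i * f = 0" "f * g i = 0" if "i \<in> {1..<p}" "f \<in> \<bb>\<^sub>2" for i f
    using that e_f by (auto simp: g_def algebra_simps)
  have gp: "g p = e p" by (simp add: g_def)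

  have MM: "x * y \<in> M" if "x \<in> M" "y \<in> M" for x y
    using that p e_e e_f b2_mult by (auto simp: M_def)
  have "M \<subseteq> G" using p gp by (auto simp: M_def G_def intro: rev_image_eqI)
  have counit1: "\<epsilon> x = 1" if "x \<in> G" for x
    using that counit_f g_counit by (auto simp: G_def)
  have "\<epsilon> 0 = 0" by (rule linear_zero[OF counit_linear])
  then have "0 \<notin> M" using counit1 \<open>M \<subseteq> G\<close> by force

  have G_cases: "x \<in> M \<or> (\<exists>i\<in>{1..<p}. x = g i)" if "x \<in> G" for x
    using that gp by (force simp: G_def M_def)
  have g_M: "g i * x = 0" "x * g i = 0" if "i \<in> {1..<p}" "x \<in> M" for i x
    using that g_b2[OF that(1)] orth[of i p] orth[of p i] by (auto simp: M_def gp)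
  have GG: "x * y = 0 \<or> (x = y \<and> x * x = x) \<or> (x \<in> M \<and> y \<in> M)" if "x \<in> G" "y \<in> G" for x y
    using G_cases[OF that(1)] G_cases[OF that(2)]
  proof (elim disjE bexE)
    fix i j assume "i \<in> {1..<p}" "j \<in> {1..<p}" "x = g i" "y = g j"
    then show ?thesis using orth[of i j] orth[of i i] by (cases "i = j") auto
  qed (auto simp: g_M)

  show ?thesis
  proof (rule weak_bialgebra_of_grouplike_span[where G = G and I = "{1..p}" and h = g])
    show "\<Delta> x = tensor2 scale x x" if "x \<in> G" for x
      using that comult_f g_grouplike by (auto simp: G_def)
    show "x * y \<in> insert 0 G" if "x \<in> G" "y \<in> G" for x y
      using GG[OF that] MM \<open>M \<subseteq> G\<close> that by auto
    \<comment> \<open>If \<open>x y\<close> and \<open>y z\<close> are nonzero, then \<open>x = y\<close> or \<open>y = z\<close> is idempotent, so that \<open>x y z\<close> is one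
      of these two products, or all three factors lie in \<open>M\<close>.\<close>
    show "x * y = 0 \<or> y * z = 0" if "x \<in> G" "y \<in> G" "z \<in> G" and 0: "x * y * z = 0" for x y z
      using GG[OF that(1,2)] GG[OF that(2,3)] 0 MM[OF MM[of x y], of z] \<open>0 \<notin> M\<close>
      by (metis mult.assoc)
    show "1 = (\<Sum>i\<in>{1..p}. g i)" using e_sum[OF p] unit by simp
  qed (use G comult_linear counit_linear counit1 orth G_def in auto)
qed

end
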